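(* The isolated singularities of a flat metric with finite area on a Riemann surface must be conical singularities. That is: let $\Sigma$ be a Riemann surface, $p\in\Sigma$, $V$ an open neighborhood of $p$, and let $\mathrm{d}\sigma^2$ be a conformal metric of Gauss curvature zero on $V\setminus\{p\}$ whose area on $V\setminus\{p\}$ is finite. Then $\mathrm{d}\sigma^2$ has a conical singularity at $p$, of cone angle $2\pi\alpha$ for some $\alpha>0$.
   Context: A conformal metric on a Riemann surface is a Riemannian metric which in any local holomorphic coordinate $w$ has the form $e^{2\varphi}|\mathrm{d}w|^2$ with $\varphi$ a smooth real function; it is called flat if its Gauss curvature is zero. A point $p$ is an isolated singularity of a conformal metric if the metric is defined (and smooth) on a punctured neighborhood of $p$. A conformal metric $\mathrm{d}\sigma^2$ has a conical singularity at $p$ with cone angle $2\pi\alpha>0$ if in a neighborhood of $p$ one has $\mathrm{d}\sigma^2=e^{2\varphi}|\mathrm{d}z|^2$, where $z$ is a local complex coordinate defined in the neighborhood of $p$ with $z(p)=0$ and $\varphi-(\alpha-1)\ln|z|$ is continuous in the neighborhood (i.e. it extends continuously across $p$). The value $\alpha=1$ is allowed. *)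

theory Defs
  imports "HOL-Analysis.Analysis"
begin

section \<open>Riemann surfaces\<close>

text \<open>A coordinate is a pair of its domain and its coordinate function; the values of the
  function outside the domain are irrelevant.\<close>

type_synonym 'a coord = "'a set \<times> ('a \<Rightarrow> complex)"

definition chart :: "'a topology \<Rightarrow> 'a coord \<Rightarrow> bool" where
  "chart X = (\<lambda>(U, w). openin X U \<and> open (w ` U) \<and>
     homeomorphic_map (subtopology X U) (top_of_set (w ` U)) w)"

definition coord_change :: "'a coord \<Rightarrow> 'a coord \<Rightarrow> complex \<Rightarrow> complex" where
  "coord_change k l = snd l \<circ> inv_into (fst k) (snd k)"

definition compatible :: "'a coord \<Rightarrow> 'a coord \<Rightarrow> bool" where
  "compatible k l \<longleftrightarrow>
     coord_change k l holomorphic_on snd k ` (fst k \<inter> fst l) \<and>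
     coord_change l k holomorphic_on snd l ` (fst k \<inter> fst l)"

definition riemann_surface :: "'a topology \<Rightarrow> 'a coord set \<Rightarrow> bool" where
  "riemann_surface X \<A> \<longleftrightarrow>
     Hausdorff_space X \<and> connected_space X \<and>
     (\<forall>k\<in>\<A>. chart X k) \<and> (\<Union>k\<in>\<A>. fst k) = topspace X \<and>
     (\<forall>k\<in>\<A>. \<forall>l\<in>\<A>. compatible k l)"

text \<open>All local holomorphic coordinates, i.e. the maximal atlas containing \<open>\<A>\<close>.\<close>

definition coords :: "'a topology \<Rightarrow> 'a coord set \<Rightarrow> 'a coord set" where
  "coords X \<A> = {k. chart X k \<and> (\<forall>l\<in>\<A>. compatible k l)}"

definition coord_image :: "'a set \<Rightarrow> 'a coord \<Rightarrow> complex set" where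
  "coord_image W k = snd k ` (fst k \<inter> W)"

section \<open>Conformal metrics\<close>

text \<open>\<open>C_times_diff n S f\<close> means that \<open>f\<close> is of class $C^n$ on the open set \<open>S\<close>.\<close>

fun C_times_diff ::
  "nat \<Rightarrow> 'a::real_normed_vector set \<Rightarrow> ('a \<Rightarrow> 'b::real_normed_vector) \<Rightarrow> bool" where
  "C_times_diff 0 S f \<longleftrightarrow> continuous_on S f"
| "C_times_diff (Suc n) S f \<longleftrightarrow>
     (\<forall>x\<in>S. f differentiable (at x)) \<and>
     (\<forall>v. C_times_diff n S (\<lambda>x. frechet_derivative f (at x) v))"

definition smooth_on :: "'a::real_normed_vector set \<Rightarrow> ('a \<Rightarrow> 'b::real_normed_vector) \<Rightarrow> bool" where
  "smooth_on S f \<longleftrightarrow> (\<forall>n. C_times_diff n S f)"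

text \<open>A metric tensor is given by its expressions in all local holomorphic coordinates:
  \<open>g k z u v\<close> is the inner product of the tangent vectors \<open>u\<close> and \<open>v\<close> at the point with
  coordinate \<open>z\<close>, all read in the coordinate \<open>k\<close>. The last clause is the transformation
  law; the differential of a holomorphic change of coordinates is multiplication by its
  complex derivative.\<close>

type_synonym 'a metric_tensor = "'a coord \<Rightarrow> complex \<Rightarrow> complex \<Rightarrow> complex \<Rightarrow> real"

definition riemannian_metric_on ::
  "'a topology \<Rightarrow> 'a coord set \<Rightarrow> 'a set \<Rightarrow> 'a metric_tensor \<Rightarrow> bool" where
  "riemannian_metric_on X \<A> W g \<longleftrightarrow>
     (\<forall>k\<in>coords X \<A>.
        (\<forall>u v. smooth_on (coord_image W k) (\<lambda>z. g k z u v)) \<and>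
        (\<forall>z\<in>coord_image W k.
           bilinear (g k z) \<and> (\<forall>u v. g k z u v = g k z v u) \<and> (\<forall>u. u \<noteq> 0 \<longrightarrow> g k z u u > 0))) \<and>
     (\<forall>k\<in>coords X \<A>. \<forall>l\<in>coords X \<A>. \<forall>z\<in>coord_image (W \<inter> fst l) k. \<forall>u v.
        g k z u v = g l (coord_change k l z)
          (deriv (coord_change k l) z * u) (deriv (coord_change k l) z * v))"

text \<open>The tensor $e^{2\varphi}|\mathrm{d}w|^2$ in the coordinate \<open>w\<close>; the inner product of the
  real vector space \<open>complex\<close> is the Euclidean one.\<close>

definition conformal_form :: "(complex \<Rightarrow> real) \<Rightarrow> complex \<Rightarrow> complex \<Rightarrow> complex \<Rightarrow> real" where
  "conformal_form \<phi> z u v = exp (2 * \<phi> z) * (u \<bullet> v)"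

definition conformal_metric_on ::
  "'a topology \<Rightarrow> 'a coord set \<Rightarrow> 'a set \<Rightarrow> 'a metric_tensor \<Rightarrow> bool" where
  "conformal_metric_on X \<A> W g \<longleftrightarrow>
     riemannian_metric_on X \<A> W g \<and>
     (\<forall>k\<in>coords X \<A>. \<exists>\<phi>. smooth_on (coord_image W k) \<phi> \<and>
        (\<forall>z\<in>coord_image W k. g k z = conformal_form \<phi> z))"

section \<open>Gauss curvature and area\<close>

text \<open>Here \<open>h\<close> is the expression of a Riemannian metric in one coordinate, with
  \<open>1\<close> and \<open>\<i>\<close> as the basis of the tangent space.
  \<open>christoffel h z u v\<close> is the covariant derivative at \<open>z\<close> of the constant
  vector field \<open>v\<close> in the direction \<open>u\<close> for the Levi-Civita connection, determined by the Koszul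
  formula.\<close>

definition christoffel ::
  "(complex \<Rightarrow> complex \<Rightarrow> complex \<Rightarrow> real) \<Rightarrow> complex \<Rightarrow> complex \<Rightarrow> complex \<Rightarrow> complex" where
  "christoffel h z u v = (THE c. \<forall>w. 2 * h z c w =
     frechet_derivative (\<lambda>x. h x v w) (at z) u +
     frechet_derivative (\<lambda>x. h x u w) (at z) v -
     frechet_derivative (\<lambda>x. h x u v) (at z) w)"

text \<open>$R(u,v)w = \nabla_u\nabla_v w - \nabla_v\nabla_u w$ for constant (hence commuting) vector
  fields \<open>u\<close>, \<open>v\<close>, \<open>w\<close>.\<close>

definition riemann_curvature ::
  "(complex \<Rightarrow> complex \<Rightarrow> complex \<Rightarrow> real) \<Rightarrow> complex \<Rightarrow> complex \<Rightarrow> complex \<Rightarrow> complex \<Rightarrow> complex" where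
  "riemann_curvature h z u v w =
     frechet_derivative (\<lambda>x. christoffel h x v w) (at z) u -
     frechet_derivative (\<lambda>x. christoffel h x u w) (at z) v +
     christoffel h z u (christoffel h z v w) - christoffel h z v (christoffel h z u w)"

definition gram_det :: "(complex \<Rightarrow> complex \<Rightarrow> complex \<Rightarrow> real) \<Rightarrow> complex \<Rightarrow> real" where
  "gram_det h z = h z 1 1 * h z \<i> \<i> - (h z 1 \<i>)\<^sup>2"

definition gauss_curvature :: "(complex \<Rightarrow> complex \<Rightarrow> complex \<Rightarrow> real) \<Rightarrow> complex \<Rightarrow> real" where
  "gauss_curvature h z = h z (riemann_curvature h z 1 \<i> \<i>) 1 / gram_det h z"

definition flat_on ::
  "'a topology \<Rightarrow> 'a coord set \<Rightarrow> 'a set \<Rightarrow> 'a metric_tensor \<Rightarrow> bool" where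
  "flat_on X \<A> W g \<longleftrightarrow>
     (\<forall>k\<in>coords X \<A>. \<forall>z\<in>coord_image W k. gauss_curvature (g k) z = 0)"

text \<open>The area of \<open>W\<close> is the supremum of the total areas of finite disjoint families of Borel
  pieces \<open>B\<close> of \<open>W\<close>, each contained in the domain of a coordinate and measured in it.\<close>

definition area_pieces :: "'a topology \<Rightarrow> 'a coord set \<Rightarrow> 'a set \<Rightarrow> ('a coord \<times> 'a set) set set" where
  "area_pieces X \<A> W =
     {P. finite P \<and>
         (\<forall>(k, B)\<in>P. k \<in> coords X \<A> \<and> B \<subseteq> fst k \<inter> W \<and> snd k ` B \<in> sets borel) \<and>
         pairwise (\<lambda>(k, B) (l, C). disjnt B C) P}"

definition area :: "'a topology \<Rightarrow> 'a coord set \<Rightarrow> 'a set \<Rightarrow> 'a metric_tensor \<Rightarrow> ennreal" where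
  "area X \<A> W g =
     (SUP P\<in>area_pieces X \<A> W. \<Sum>(k, B)\<in>P.
        \<integral>\<^sup>+z\<in>snd k ` B. ennreal (sqrt (gram_det (g k) z)) \<partial>lborel)"

section \<open>Conical singularities\<close>

text \<open>\<open>W\<close> is the domain of the metric and \<open>\<theta>\<close> is the cone angle $2\pi\alpha$. The function \<open>f\<close> is the
  continuous extension of $\varphi-(\alpha-1)\ln|z|$ across \<open>p\<close>, which has the coordinate 0.\<close>

definition conical_singularity ::
  "'a topology \<Rightarrow> 'a coord set \<Rightarrow> 'a set \<Rightarrow> 'a metric_tensor \<Rightarrow> 'a \<Rightarrow> real \<Rightarrow> bool" where
  "conical_singularity X \<A> W g p \<theta> \<longleftrightarrow>
     \<theta> > 0 \<and>
     (\<exists>U z. (U, z) \<in> coords X \<A> \<and> p \<in> U \<and> U - {p} \<subseteq> W \<and> z p = 0 \<and>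
        (\<exists>\<phi> f. (\<forall>x\<in>z ` U - {0}. g (U, z) x = conformal_form \<phi> x) \<and>
               continuous_on (z ` U) f \<and>
               (\<forall>x\<in>z ` U - {0}. \<phi> x - (\<theta> / (2 * pi) - 1) * ln (cmod x) = f x)))"

end

theory Submission
  imports Defs "HOL-Complex_Analysis.Complex_Analysis"
begin

text \<open>In a coordinate disc centred at \<open>p\<close> the metric is $e^{2\varphi}|\mathrm{d}z|^2$ on the punctured disc,
  and its curvature is $-e^{-2\varphi}\Delta\varphi$; so flatness means that \<open>\<phi>\<close> is harmonic, and
  $2\,\partial\varphi/\partial z$ is holomorphic. A harmonic function on a punctured disc is
  $\varphi = \mathrm{Re}\, G + c\ln|z|$ with \<open>G\<close> holomorphic on the punctured disc and \<open>c\<close> real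
  (\<open>punctured_disc_log_decomposition\<close>), but \<open>G\<close> may be very singular at 0 and \<open>c\<close> may be
  arbitrary. Finite area controls both.

  The function $e^{2\varphi}$ is locally the modulus of a holomorphic function, so its value at \<open>z\<close> is
  bounded by a constant times its mean over the disc of radius $|z|$ about \<open>z\<close>
  (\<open>holomorphic_norm_le_area_integral\<close>). These discs lie in the punctured disc of radius $2|z|$,
  whose area in the metric tends to 0. Hence $|z|e^{\varphi}\to 0$ (\<open>finite_area_decay\<close>): geometrically,
  circles around a puncture of finite area become short.

  For a natural number $n\ge 1+c$ the function $z^n e^{G}$ has modulus at most $|z|e^{\varphi}$ near 0, so
  it tends to 0 and its singularity is removable. It therefore factors as $z^m g$ with $g(0)\ne 0$, and
  taking logarithms of moduli, $\varphi = (\alpha-1)\ln|z| + \ln|g|$ with $\alpha = m-n+c+1$. The same decay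
  reads $|z|^{\alpha}|g|\to 0$, which forces $\alpha>0$ (\<open>finite_area_logarithmic_pole\<close>).\<close>

section \<open>Smooth functions and symmetry of second derivatives\<close>

abbreviation partial :: "complex \<Rightarrow> (complex \<Rightarrow> 'b::real_normed_vector) \<Rightarrow> complex \<Rightarrow> 'b" where
  "partial v f \<equiv> \<lambda>x. frechet_derivative f (at x) v"

lemma smooth_on_differentiable:
  assumes "smooth_on S f" "x \<in> S"
  shows "f differentiable (at x)"
  using assms unfolding smooth_on_def by (metis C_times_diff.simps(2))

lemma smooth_on_partial:
  assumes "smooth_on S f"
  shows "smooth_on S (partial v f)"
  using assms unfolding smooth_on_def by (metis C_times_diff.simps(2))

lemma smooth_on_continuous:
  assumes "smooth_on S f"
  shows "continuous_on S f"
  using assms unfolding smooth_on_def by (metis C_times_diff.simps(1))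

text \<open>The second difference of \<open>\<phi>\<close> along a small parallelogram is symmetric in the two sides, while
  two applications of the mean value theorem express it by the iterated derivative in one chosen
  order; comparing both orders gives the symmetry of second derivatives below.\<close>
lemma second_difference_mean_value:
  fixes \<phi> :: "complex \<Rightarrow> real"
  assumes \<phi>: "\<And>x. x \<in> ball z r \<Longrightarrow> \<phi> differentiable (at x)"
    and d\<phi>: "\<And>x. x \<in> ball z r \<Longrightarrow> partial u \<phi> differentiable (at x)"
    and h: "0 < h" "h * (cmod u + cmod v) < r"
  obtains s t where "0 < s" "s < h" "0 < t" "t < h"
    "\<phi> (z + h *\<^sub>R u + h *\<^sub>R v) - \<phi> (z + h *\<^sub>R u) - \<phi> (z + h *\<^sub>R v) + \<phi> z
       = h\<^sup>2 * partial v (partial u \<phi>) (z + s *\<^sub>R u + t *\<^sub>R v)"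
proof -
  have in_ball: "z + s *\<^sub>R u + t *\<^sub>R v \<in> ball z r" if "0 \<le> s" "s \<le> h" "0 \<le> t" "t \<le> h" for s t
  proof -
    have "cmod (s *\<^sub>R u + t *\<^sub>R v) \<le> s * cmod u + t * cmod v"
      using that norm_triangle_ineq[of "s *\<^sub>R u" "t *\<^sub>R v"] by simp
    also have "\<dots> \<le> h * cmod u + h * cmod v"
      using that by (intro add_mono mult_right_mono) auto
    finally show ?thesis using h(2) by (simp add: dist_norm algebra_simps norm_minus_commute[of z] flip: norm_minus_cancel[of "s *\<^sub>R u + t *\<^sub>R v"])
  qed
  have line: "((\<lambda>s. f (a + s *\<^sub>R w)) has_real_derivative partial w f (a + s *\<^sub>R w)) (at s)"
    if "f differentiable (at (a + s *\<^sub>R w))" for f :: "complex \<Rightarrow> real" and a w s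
  proof -
    have "(f has_derivative frechet_derivative f (at (a + s *\<^sub>R w))) (at (a + s *\<^sub>R w))"
      using that by (simp add: frechet_derivative_works)
    then have "(f \<circ> (\<lambda>s. a + s *\<^sub>R w) has_derivative
        frechet_derivative f (at (a + s *\<^sub>R w)) \<circ> (\<lambda>t. t *\<^sub>R w)) (at s)"
      by (intro diff_chain_at) (auto intro!: derivative_eq_intros)
    moreover have "frechet_derivative f (at (a + s *\<^sub>R w)) (t *\<^sub>R w) = partial w f (a + s *\<^sub>R w) * t" for t
      using linear_frechet_derivative[OF that] by (simp add: linear_cmul)
    ultimately show ?thesis
      by (simp add: has_field_derivative_def o_def)
  qed
  define D where "D = (\<lambda>s. \<phi> (z + h *\<^sub>R v + s *\<^sub>R u) - \<phi> (z + s *\<^sub>R u))"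
  have "\<exists>s. 0 < s \<and> s < h \<and> D h - D 0 = (h - 0) *
      (partial u \<phi> (z + h *\<^sub>R v + s *\<^sub>R u) - partial u \<phi> (z + s *\<^sub>R u))"
  proof (rule MVT2[OF h(1)])
    fix s assume s: "0 \<le> s" "s \<le> h"
    show "(D has_real_derivative partial u \<phi> (z + h *\<^sub>R v + s *\<^sub>R u) - partial u \<phi> (z + s *\<^sub>R u)) (at s)"
      unfolding D_def
      using in_ball[OF s, of h] in_ball[OF s, of 0] h(1) s
      by (intro DERIV_diff line \<phi>) (simp_all add: add_ac)
  qed
  then obtain s where s: "0 < s" "s < h"
    "D h - D 0 = h * (partial u \<phi> (z + h *\<^sub>R v + s *\<^sub>R u) - partial u \<phi> (z + s *\<^sub>R u))"
    by auto
  have "\<exists>t. 0 < t \<and> t < h \<and> partial u \<phi> (z + s *\<^sub>R u + h *\<^sub>R v) - partial u \<phi> (z + s *\<^sub>R u + 0 *\<^sub>R v)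
      = (h - 0) * partial v (partial u \<phi>) (z + s *\<^sub>R u + t *\<^sub>R v)"
  proof (rule MVT2[OF h(1)])
    fix t assume t: "0 \<le> t" "t \<le> h"
    show "((\<lambda>t. partial u \<phi> (z + s *\<^sub>R u + t *\<^sub>R v)) has_real_derivative
        partial v (partial u \<phi>) (z + s *\<^sub>R u + t *\<^sub>R v)) (at t)"
      using in_ball[of s t] s t by (intro line d\<phi>) auto
  qed
  then obtain t where t: "0 < t" "t < h" "partial u \<phi> (z + s *\<^sub>R u + h *\<^sub>R v) - partial u \<phi> (z + s *\<^sub>R u)
      = h * partial v (partial u \<phi>) (z + s *\<^sub>R u + t *\<^sub>R v)"
    by auto
  have "D h - D 0 = h\<^sup>2 * partial v (partial u \<phi>) (z + s *\<^sub>R u + t *\<^sub>R v)"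
    using s(3) t(3) by (simp add: power2_eq_square add_ac mult_ac)
  then show ?thesis
    using s t that[of s t] unfolding D_def by (simp add: add_ac algebra_simps)
qed

text \<open>If the two mixed derivatives differed at \<open>z\<close>, then by continuity no value of one near \<open>z\<close> would be
  a value of the other near \<open>z\<close>; but a small second difference quotient is a value of both.\<close>
lemma partial_commute:
  fixes \<phi> :: "complex \<Rightarrow> real"
  assumes \<phi>: "smooth_on S \<phi>" and S: "open S" "z \<in> S"
  shows "partial v (partial u \<phi>) z = partial u (partial v \<phi>) z"
proof (rule ccontr)
  assume ne: "partial v (partial u \<phi>) z \<noteq> partial u (partial v \<phi>) z"
  define e where "e = \<bar>partial v (partial u \<phi>) z - partial u (partial v \<phi>) z\<bar> / 2"
  have e: "e > 0" using ne by (simp add: e_def)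
  have close: "\<exists>d>0. \<forall>x. dist x z < d \<longrightarrow> dist (partial v (partial u \<phi>) x) (partial v (partial u \<phi>) z) < e" for u v
  proof -
    have "isCont (partial v (partial u \<phi>)) z"
      using smooth_on_continuous[OF smooth_on_partial[OF smooth_on_partial[OF \<phi>]], of u v] S
      by (simp add: continuous_on_eq_continuous_at)
    then show ?thesis
      using e unfolding continuous_at_eps_delta by blast
  qed
  obtain d1 where d1: "d1 > 0" "\<And>x. dist x z < d1 \<Longrightarrow> dist (partial v (partial u \<phi>) x) (partial v (partial u \<phi>) z) < e"
    using close by blast
  obtain d2 where d2: "d2 > 0" "\<And>x. dist x z < d2 \<Longrightarrow> dist (partial u (partial v \<phi>) x) (partial u (partial v \<phi>) z) < e"
    using close by blast
  obtain d3 where d3: "d3 > 0" "ball z d3 \<subseteq> S"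
    using S openE by blast
  define r where "r = min d1 (min d2 d3)"
  \<comment> \<open>This step size keeps both parallelograms inside the ball where the derivatives vary by less than \<open>e\<close>.\<close>
  define h where "h = r / (2 * (cmod u + cmod v + 1))"
  have r: "r > 0" using d1 d2 d3 by (simp add: r_def)
  have pos: "cmod u + cmod v + 1 > 0" by (simp add: add_nonneg_pos)
  then have h: "h > 0" using r by (simp add: h_def)
  have "h * (cmod u + cmod v) < h * (2 * (cmod u + cmod v + 1))"
    using h pos by (intro mult_strict_left_mono) (smt (verit) norm_ge_zero)+
  also have "\<dots> = r" using pos by (simp add: h_def field_simps)
  finally have hr: "h * (cmod u + cmod v) < r" .
  have sub: "x \<in> S" if "x \<in> ball z r" for x using that d3 by (auto simp: r_def)
  obtain s t where st: "0 < s" "s < h" "0 < t" "t < h"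
    "\<phi> (z + h *\<^sub>R u + h *\<^sub>R v) - \<phi> (z + h *\<^sub>R u) - \<phi> (z + h *\<^sub>R v) + \<phi> z
       = h\<^sup>2 * partial v (partial u \<phi>) (z + s *\<^sub>R u + t *\<^sub>R v)"
    by (rule second_difference_mean_value[of z r \<phi> u h v])
       (use \<phi> sub h hr in \<open>auto intro: smooth_on_differentiable smooth_on_partial\<close>)
  obtain s' t' where st': "0 < s'" "s' < h" "0 < t'" "t' < h"
    "\<phi> (z + h *\<^sub>R v + h *\<^sub>R u) - \<phi> (z + h *\<^sub>R v) - \<phi> (z + h *\<^sub>R u) + \<phi> z
       = h\<^sup>2 * partial u (partial v \<phi>) (z + s' *\<^sub>R v + t' *\<^sub>R u)"
    by (rule second_difference_mean_value[of z r \<phi> v h u])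
       (use \<phi> sub h hr in \<open>auto intro: smooth_on_differentiable smooth_on_partial simp: add.commute\<close>)
  have "dist (z + s *\<^sub>R u + t *\<^sub>R v) z < r" if "0 < s" "s < h" "0 < t" "t < h" for s t
  proof -
    have "cmod (s *\<^sub>R u + t *\<^sub>R v) \<le> s * cmod u + t * cmod v"
      using that norm_triangle_ineq[of "s *\<^sub>R u" "t *\<^sub>R v"] by simp
    also have "\<dots> \<le> h * cmod u + h * cmod v"
      using that by (intro add_mono mult_right_mono) auto
    finally show ?thesis using hr by (simp add: dist_norm algebra_simps)
  qed
  note near = this
  have "dist (z + s *\<^sub>R u + t *\<^sub>R v) z < r" "dist (z + t' *\<^sub>R u + s' *\<^sub>R v) z < r"
    using near[OF st(1-4)] near[OF st'(3,4,1,2)] .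
  then have "dist (partial v (partial u \<phi>) (z + s *\<^sub>R u + t *\<^sub>R v)) (partial v (partial u \<phi>) z) < e"
    "dist (partial u (partial v \<phi>) (z + s' *\<^sub>R v + t' *\<^sub>R u)) (partial u (partial v \<phi>) z) < e"
    using d1(2) d2(2) by (auto simp: r_def add_ac)
  moreover have "h\<^sup>2 * partial v (partial u \<phi>) (z + s *\<^sub>R u + t *\<^sub>R v)
      = h\<^sup>2 * partial u (partial v \<phi>) (z + s' *\<^sub>R v + t' *\<^sub>R u)"
    using st(5) st'(5) add.commute[of "h *\<^sub>R u" "h *\<^sub>R v"] by (simp only: add.assoc)
  ultimately show False
    using h unfolding e_def dist_real_def by (simp add: abs_if field_simps split: if_splits)
qed

text \<open>This is $2\,\partial\varphi/\partial z$, normalised so that the real part of its product with \<open>v\<close> is the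
  directional derivative along \<open>v\<close>.\<close>
definition complex_gradient :: "(complex \<Rightarrow> real) \<Rightarrow> complex \<Rightarrow> complex" where
  "complex_gradient \<phi> z = Complex (partial 1 \<phi> z) (- partial \<i> \<phi> z)"

lemma partial_eq:
  fixes f :: "complex \<Rightarrow> 'b::real_normed_vector"
  assumes "f differentiable (at z)"
  shows "partial v f z = Re v *\<^sub>R partial 1 f z + Im v *\<^sub>R partial \<i> f z"
proof -
  have "linear (frechet_derivative f (at z))"
    by (rule linear_frechet_derivative[OF assms])
  moreover have "v = Re v *\<^sub>R 1 + Im v *\<^sub>R \<i>"
    by (simp add: complex_eq_iff)
  ultimately show ?thesis
    using linear_add[of "frechet_derivative f (at z)" "Re v *\<^sub>R 1" "Im v *\<^sub>R \<i>"]
    by (simp add: linear_cmul)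
qed

lemma has_derivative_complex_gradient:
  assumes "\<phi> differentiable (at z)"
  shows "(\<phi> has_derivative (\<lambda>v. Re (complex_gradient \<phi> z * v))) (at z)"
proof -
  have "frechet_derivative \<phi> (at z) = (\<lambda>v. Re (complex_gradient \<phi> z * v))"
    by (rule ext, subst partial_eq[OF assms]) (simp add: complex_gradient_def mult.commute)
  then show ?thesis using assms by (metis frechet_derivative_works)
qed

text \<open>The Cauchy--Riemann equations for $\varphi_x - i\varphi_y$ are the vanishing of the Laplacian together with
  the symmetry of the mixed derivatives.\<close>
lemma complex_gradient_holomorphic:
  assumes \<phi>: "smooth_on S \<phi>" and S: "open S"
    and harm: "\<And>z. z \<in> S \<Longrightarrow> partial 1 (partial 1 \<phi>) z + partial \<i> (partial \<i> \<phi>) z = 0"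
  shows "complex_gradient \<phi> holomorphic_on S"
proof -
  have "\<exists>D. (complex_gradient \<phi> has_field_derivative D) (at z)" if z: "z \<in> S" for z
  proof -
    have d: "partial u \<phi> differentiable (at z)" for u
      using smooth_on_differentiable[OF smooth_on_partial[OF \<phi>] z] .
    have *: "(partial u \<phi> has_derivative frechet_derivative (partial u \<phi>) (at z)) (at z)" for u
      using d frechet_derivative_works by blast
    have "((\<lambda>x. of_real (partial 1 \<phi> x) - \<i> * of_real (partial \<i> \<phi> x)) has_derivative
       (\<lambda>v. of_real (frechet_derivative (partial 1 \<phi>) (at z) v) - \<i> * of_real (frechet_derivative (partial \<i> \<phi>) (at z) v))) (at z)"
      by (rule derivative_eq_intros * refl)+
    moreover have "(\<lambda>x. of_real (partial 1 \<phi> x) - \<i> * of_real (partial \<i> \<phi> x)) = complex_gradient \<phi>"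
      by (simp add: complex_gradient_def fun_eq_iff complex_eq_iff)
    moreover have "of_real (frechet_derivative (partial 1 \<phi>) (at z) v) - \<i> * of_real (frechet_derivative (partial \<i> \<phi>) (at z) v)
       = Complex (partial 1 (partial 1 \<phi>) z) (- partial 1 (partial \<i> \<phi>) z) * v" for v
    proof -
      have 1: "frechet_derivative (partial u \<phi>) (at z) v =
          Re v * partial 1 (partial u \<phi>) z + Im v * partial \<i> (partial u \<phi>) z" for u
        using partial_eq[OF d[of u], of v] by simp
      have 2: "partial \<i> (partial 1 \<phi>) z = partial 1 (partial \<i> \<phi>) z"
        by (rule partial_commute[OF \<phi> S z])
      have 3: "partial \<i> (partial \<i> \<phi>) z = - partial 1 (partial 1 \<phi>) z"
        using harm[OF z] by linarith
      show ?thesis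
        unfolding 1 2 3 by (simp add: complex_eq_iff mult.commute)
    qed
    ultimately show ?thesis
      by (auto simp: has_field_derivative_def)
  qed
  then show ?thesis
    using S by (auto simp: holomorphic_on_open)
qed

section \<open>Curvature of a conformal metric\<close>

lemma frechet_derivative_cong_open:
  assumes "open S" "z \<in> S" "\<And>x. x \<in> S \<Longrightarrow> f x = g x"
  shows "frechet_derivative f (at z) = frechet_derivative g (at z)"
proof -
  have "(f has_derivative D) (at z) \<longleftrightarrow> (g has_derivative D) (at z)" for D
    using assms by (metis has_derivative_transform_within_open)
  then show ?thesis by (simp add: frechet_derivative_def)
qed

text \<open>The vector on the right satisfies the Koszul formula, and the inner product is nondegenerate, so it
  is the one that the definite description picks.\<close>
lemma christoffel_conformal:
  assumes \<phi>: "smooth_on S \<phi>" and S: "open S" "z \<in> S"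
    and h: "\<And>x. x \<in> S \<Longrightarrow> h x = conformal_form \<phi> x"
  shows "christoffel h z u v = partial u \<phi> z *\<^sub>R v + partial v \<phi> z *\<^sub>R u
           - (u \<bullet> v) *\<^sub>R Complex (partial 1 \<phi> z) (partial \<i> \<phi> z)"
proof -
  have d\<phi>: "(\<phi> has_derivative frechet_derivative \<phi> (at z)) (at z)"
    using smooth_on_differentiable[OF \<phi> S(2)] frechet_derivative_works by blast
  have fd: "frechet_derivative (\<lambda>x. h x a b) (at z) c
      = 2 * exp (2 * \<phi> z) * partial c \<phi> z * (a \<bullet> b)" for a b c
  proof -
    have "frechet_derivative (\<lambda>x. h x a b) (at z)
        = frechet_derivative (\<lambda>x. exp (2 * \<phi> x) * (a \<bullet> b)) (at z)"
      by (rule frechet_derivative_cong_open[OF S]) (simp add: h conformal_form_def)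
    also have "\<dots> = (\<lambda>c. 2 * exp (2 * \<phi> z) * partial c \<phi> z * (a \<bullet> b))"
      by (rule frechet_derivative_at[symmetric]) (auto intro!: derivative_eq_intros d\<phi>)
    finally show ?thesis by simp
  qed
  define c0 where "c0 = partial u \<phi> z *\<^sub>R v + partial v \<phi> z *\<^sub>R u
           - (u \<bullet> v) *\<^sub>R Complex (partial 1 \<phi> z) (partial \<i> \<phi> z)"
  have grad: "partial w \<phi> z = Complex (partial 1 \<phi> z) (partial \<i> \<phi> z) \<bullet> w" for w
    using partial_eq[OF smooth_on_differentiable[OF \<phi> S(2)], of w]
    by (simp add: inner_complex_def mult.commute)
  have iff: "2 * h z c w = frechet_derivative (\<lambda>x. h x v w) (at z) u +
     frechet_derivative (\<lambda>x. h x u w) (at z) v -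
     frechet_derivative (\<lambda>x. h x u v) (at z) w \<longleftrightarrow> c \<bullet> w = c0 \<bullet> w" for c w
  proof -
    have "frechet_derivative (\<lambda>x. h x v w) (at z) u + frechet_derivative (\<lambda>x. h x u w) (at z) v -
       frechet_derivative (\<lambda>x. h x u v) (at z) w
       = 2 * exp (2 * \<phi> z) * (partial u \<phi> z * (v \<bullet> w) + partial v \<phi> z * (u \<bullet> w) - partial w \<phi> z * (u \<bullet> v))"
      unfolding fd by (simp add: algebra_simps)
    also have "partial u \<phi> z * (v \<bullet> w) + partial v \<phi> z * (u \<bullet> w) - partial w \<phi> z * (u \<bullet> v) = c0 \<bullet> w"
      unfolding c0_def grad[of w] by (simp add: inner_add_left inner_diff_left)
    finally show ?thesis
      using h[OF S(2)] by (simp add: conformal_form_def)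
  qed
  have "christoffel h z u v = (THE c. \<forall>w. c \<bullet> w = c0 \<bullet> w)"
    unfolding christoffel_def iff ..
  also have "\<dots> = c0"
    by (rule the_equality) (auto intro: vector_eq_rdot[THEN iffD1])
  finally show ?thesis unfolding c0_def .
qed

text \<open>Liouville's formula. The terms of the curvature tensor that are quadratic in the first derivatives
  of \<open>\<phi>\<close> cancel: in complex notation the Christoffel form of \<open>u\<close> and \<open>v\<close> is their product with
  $2\,\partial\varphi/\partial z$, and complex multiplications commute. Only the second derivatives remain.\<close>
lemma gauss_curvature_conformal:
  assumes \<phi>: "smooth_on S \<phi>" and S: "open S" "z \<in> S"
    and h: "\<And>x. x \<in> S \<Longrightarrow> h x = conformal_form \<phi> x"
  shows "gauss_curvature h z
           = - exp (- 2 * \<phi> z) * (partial 1 (partial 1 \<phi>) z + partial \<i> (partial \<i> \<phi>) z)"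
proof -
  define p q where "p = partial 1 \<phi>" and "q = partial \<i> \<phi>"
  have \<Gamma>: "christoffel h x u v = partial u \<phi> x *\<^sub>R v + partial v \<phi> x *\<^sub>R u - (u \<bullet> v) *\<^sub>R Complex (p x) (q x)"
    if "x \<in> S" for x u v
    unfolding p_def q_def by (rule christoffel_conformal[OF \<phi> S(1) that h])
  have lin: "partial v \<phi> z = Re v * p z + Im v * q z" for v
    using partial_eq[OF smooth_on_differentiable[OF \<phi> S(2)], of v] by (simp add: p_def q_def)
  have d: "(p has_derivative frechet_derivative p (at z)) (at z)" "(q has_derivative frechet_derivative q (at z)) (at z)"
    using smooth_on_differentiable[OF smooth_on_partial[OF \<phi>] S(2)] frechet_derivative_works
    unfolding p_def q_def by blast+
  have "frechet_derivative (\<lambda>x. christoffel h x \<i> \<i>) (at z) 1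
      = frechet_derivative (\<lambda>x. \<i> * of_real (q x) - of_real (p x)) (at z) 1"
    by (subst frechet_derivative_cong_open[OF S, where g="\<lambda>x. \<i> * of_real (q x) - of_real (p x)"])
       (auto simp: \<Gamma> complex_eq_iff q_def)
  also have "\<dots> = \<i> * of_real (partial 1 q z) - of_real (partial 1 p z)"
    by (subst frechet_derivative_at[symmetric]) (auto intro!: derivative_eq_intros d)
  finally have d1: "frechet_derivative (\<lambda>x. christoffel h x \<i> \<i>) (at z) 1
      = \<i> * of_real (partial 1 q z) - of_real (partial 1 p z)" .
  have "frechet_derivative (\<lambda>x. christoffel h x 1 \<i>) (at z) \<i>
      = frechet_derivative (\<lambda>x. \<i> * of_real (p x) + of_real (q x)) (at z) \<i>"
    by (subst frechet_derivative_cong_open[OF S, where g="\<lambda>x. \<i> * of_real (p x) + of_real (q x)"])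
       (auto simp: \<Gamma> complex_eq_iff p_def q_def)
  also have "\<dots> = \<i> * of_real (partial \<i> p z) + of_real (partial \<i> q z)"
    by (subst frechet_derivative_at[of _ "\<lambda>v. \<i> * of_real (partial v p z) + of_real (partial v q z)", symmetric])
       (auto intro!: derivative_eq_intros d)
  finally have d2: "frechet_derivative (\<lambda>x. christoffel h x 1 \<i>) (at z) \<i>
      = \<i> * of_real (partial \<i> p z) + of_real (partial \<i> q z)" .
  have R: "Re (riemann_curvature h z 1 \<i> \<i>) = - (partial 1 p z + partial \<i> q z)"
    unfolding riemann_curvature_def d1 d2
    by (simp add: \<Gamma>[OF S(2)] lin algebra_simps inner_complex_def)
  define E where "E = exp (2 * \<phi> z)"
  have E: "E > 0" "exp (- 2 * \<phi> z) = 1 / E"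
    by (simp_all add: E_def exp_minus field_simps)
  have "gauss_curvature h z = E * Re (riemann_curvature h z 1 \<i> \<i>) / (E * E)"
    using h[OF S(2)]
    by (simp add: gauss_curvature_def gram_det_def conformal_form_def inner_complex_def E_def)
  also have "\<dots> = Re (riemann_curvature h z 1 \<i> \<i>) / E"
    using E(1) by simp
  finally show ?thesis
    unfolding R E(2) by (simp add: p_def q_def diff_divide_distrib add_divide_distrib)
qed

lemma gram_det_conformal:
  assumes "h z = conformal_form \<phi> z"
  shows "gram_det h z = (exp (2 * \<phi> z))\<^sup>2"
  using assms by (simp add: gram_det_def conformal_form_def power2_eq_square)

section \<open>A mean value estimate\<close>

text \<open>Cauchy's formula on a circle whose centre \<open>a\<close> need not be \<open>z\<close>: as long as \<open>z\<close> is within half the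
  radius of the centre, the Cauchy kernel costs only a factor 2. Having a whole disc of admissible
  centres is what lets the next lemma average over them.\<close>
lemma holomorphic_norm_le_circle_integral:
  assumes K: "K holomorphic_on ball z (2 * s)" and s: "s > 0" and a: "a \<in> ball z (s / 2)"
  shows "ennreal (cmod (K z))
           \<le> (\<integral>\<^sup>+t. indicator {0..1} t * ennreal (2 * cmod (K (a + s *\<^sub>R cis (2 * pi * t)))) \<partial>lborel)"
proof -
  define \<gamma> where "\<gamma> t = a + s *\<^sub>R cis (2 * pi * t)" for t
  define G where "G t = K (\<gamma> t) * (s *\<^sub>R cis (2 * pi * t)) / (\<gamma> t - z)" for t
  have sub: "cball a s \<subseteq> ball z (2 * s)"
  proof
    fix x assume "x \<in> cball a s"
    then show "x \<in> ball z (2 * s)"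
      using a s dist_triangle[of z x a] by simp
  qed
  then have sub': "ball a s \<subseteq> ball z (2 * s)"
    using ball_subset_cball by blast
  have \<gamma>_in: "\<gamma> t \<in> ball z (2 * s)" for t
    using s by (intro subsetD[OF sub]) (simp add: \<gamma>_def dist_norm)
  have \<gamma>_far: "cmod (\<gamma> t - z) \<ge> s / 2" for t
  proof -
    have "s = cmod (\<gamma> t - a)" using s by (simp add: \<gamma>_def)
    also have "\<dots> \<le> cmod (\<gamma> t - z) + cmod (z - a)"
      using norm_triangle_ineq[of "\<gamma> t - z" "z - a"] by simp
    finally show ?thesis using a by (simp add: dist_norm)
  qed
  have "((\<lambda>u. K u / (u - z)) has_contour_integral (2 * of_real pi * \<i> * K z)) (circlepath a s)"
    using a s
    by (intro Cauchy_integral_circlepath holomorphic_on_subset[OF K sub']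
          continuous_on_subset[OF holomorphic_on_imp_continuous_on[OF K] sub])
       (simp add: dist_norm norm_minus_commute)
  then have "((\<lambda>t. K (circlepath a s t) / (circlepath a s t - z)
       * vector_derivative (circlepath a s) (at t within {0..1})) has_integral 2 * of_real pi * \<i> * K z) {0..1}"
    by (simp add: has_contour_integral_def)
  moreover have "K (circlepath a s t) / (circlepath a s t - z)
       * vector_derivative (circlepath a s) (at t within {0..1}) = 2 * of_real pi * \<i> * G t"
    if "t \<in> {0..1}" for t
  proof -
    have "circlepath a s t = \<gamma> t"
      by (simp add: circlepath \<gamma>_def cis_conv_exp scaleR_conv_of_real mult_ac)
    moreover have "vector_derivative (circlepath a s) (at t within {0..1})
        = 2 * of_real pi * \<i> * (s *\<^sub>R cis (2 * pi * t))"
      using that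
      by (subst vector_derivative_circlepath01) (simp_all add: cis_conv_exp scaleR_conv_of_real mult_ac)
    ultimately show ?thesis
      by (simp add: G_def scaleR_conv_of_real mult_ac)
  qed
  ultimately have "((\<lambda>t. 2 * of_real pi * \<i> * G t) has_integral 2 * of_real pi * \<i> * K z) {0..1}"
    by (rule has_integral_eq[rotated])
  then have G: "(G has_integral K z) {0..1}"
    by (subst (asm) has_integral_mult_right_iff) simp_all
  have "continuous_on {0..1} G"
    unfolding G_def
    using \<gamma>_far s
    by (intro continuous_intros continuous_on_compose2[OF holomorphic_on_imp_continuous_on[OF K]])
       (use \<gamma>_in in \<open>auto simp: \<gamma>_def intro!: continuous_intros, (metis \<gamma>_def \<gamma>_far diff_self half_gt_zero norm_zero not_less)+\<close>)
  then have int: "set_integrable lborel {0..1} G"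
    by (rule borel_integrable_atLeastAtMost')
  have "(LINT t:{0..1}|lborel. G t) = K z"
    using set_borel_integral_eq_integral(2)[OF int] G by (simp add: integral_unique)
  then have "ennreal (cmod (K z)) \<le> (\<integral>\<^sup>+t. ennreal (cmod (indicator {0..1} t *\<^sub>R G t)) \<partial>lborel)"
    using integral_norm_bound_ennreal[OF int[unfolded set_integrable_def]]
    by (simp add: set_lebesgue_integral_def)
  also have "\<dots> \<le> (\<integral>\<^sup>+t. indicator {0..1} t * ennreal (2 * cmod (K (\<gamma> t))) \<partial>lborel)"
  proof (rule nn_integral_mono)
    fix t
    have "0 < cmod (\<gamma> t - z)" using \<gamma>_far[of t] s by linarith
    then have "cmod (K (\<gamma> t)) * s / cmod (\<gamma> t - z) \<le> cmod (K (\<gamma> t)) * s / (s / 2)"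
      using \<gamma>_far[of t] s by (intro divide_left_mono mult_pos_pos) auto
    then have "cmod (G t) \<le> 2 * cmod (K (\<gamma> t))"
      using s by (simp add: G_def norm_mult norm_divide mult_ac)
    then show "ennreal (cmod (indicator {0..1} t *\<^sub>R G t)) \<le> indicator {0..1} t * ennreal (2 * cmod (K (\<gamma> t)))"
      by (auto simp: indicator_def intro: ennreal_leI)
  qed
  finally show ?thesis by (simp add: \<gamma>_def)
qed

text \<open>Averaging the circle estimate over all centres \<open>a\<close> in a disc turns circle integrals into an area
  integral by Tonelli's theorem and translation invariance alone: for each fixed angle the points
  \<open>c t + a\<close> sweep out a translate of the disc of centres.\<close>
lemma holomorphic_norm_le_area_integral:
  assumes K: "K holomorphic_on ball z (2 * s)" and s: "s > 0"
  shows "ennreal (cmod (K z)) * emeasure lborel (ball z (s / 2))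
           \<le> 2 * (\<integral>\<^sup>+x\<in>ball z (2 * s). ennreal (cmod (K x)) \<partial>lborel)"
proof -
  \<comment> \<open>\<open>K\<close> is cut off outside the ball: this makes it measurable, and lets the centres range over the whole plane in the Tonelli step.\<close>
  define k where "k x = ennreal (cmod (indicator (ball z (2 * s)) x *\<^sub>R K x))" for x
  have k_meas [measurable]: "k \<in> borel_measurable borel"
    unfolding k_def
    using borel_measurable_continuous_on_indicator[OF _ holomorphic_on_imp_continuous_on[OF K]]
    by measurable
  define c where "c t = s *\<^sub>R cis (2 * pi * t)" for t :: real
  have [measurable]: "c \<in> borel_measurable borel"
    unfolding c_def by (intro borel_measurable_continuous_onI continuous_intros)
  have "ennreal (cmod (K z)) * emeasure lborel (ball z (s / 2))
      = (\<integral>\<^sup>+a\<in>ball z (s / 2). ennreal (cmod (K z)) \<partial>lborel)"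
    by (simp add: nn_integral_cmult_indicator)
  also have "\<dots> \<le> (\<integral>\<^sup>+a. \<integral>\<^sup>+t. 2 * (k (c t + a) * indicator {0..1} t) \<partial>lborel \<partial>lborel)"
  proof (rule nn_integral_mono)
    fix a :: complex
    show "ennreal (cmod (K z)) * indicator (ball z (s / 2)) a
        \<le> (\<integral>\<^sup>+t. 2 * (k (c t + a) * indicator {0..1} t) \<partial>lborel)"
    proof (cases "a \<in> ball z (s / 2)")
      case True
      have in_ball: "a + c t \<in> ball z (2 * s)" for t
        using True s dist_triangle[of z "a + c t" a] by (simp add: c_def dist_norm)
      have "ennreal (cmod (K z))
          \<le> (\<integral>\<^sup>+t. indicator {0..1} t * ennreal (2 * cmod (K (a + s *\<^sub>R cis (2 * pi * t)))) \<partial>lborel)"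
        by (rule holomorphic_norm_le_circle_integral[OF K s True])
      also have "\<dots> = (\<integral>\<^sup>+t. 2 * (k (c t + a) * indicator {0..1} t) \<partial>lborel)"
        using in_ball by (intro nn_integral_cong) (simp add: k_def c_def ennreal_mult' add.commute mult_ac)
      finally show ?thesis using True by simp
    qed simp
  qed
  also have "\<dots> = (\<integral>\<^sup>+t. \<integral>\<^sup>+a. 2 * (k (c t + a) * indicator {0..1} t) \<partial>lborel \<partial>lborel)"
    by (rule lborel_pair.Fubini') measurable
  also have "\<dots> = (\<integral>\<^sup>+t. 2 * (\<integral>\<^sup>+a. k a \<partial>lborel) * indicator {0..1::real} t \<partial>lborel)"
  proof (rule nn_integral_cong)
    fix t :: real
    have "(\<integral>\<^sup>+a. k (c t + a) \<partial>lborel) = (\<integral>\<^sup>+a. k a \<partial>distr lborel borel ((+) (c t)))"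
      by (subst nn_integral_distr) auto
    also have "\<dots> = (\<integral>\<^sup>+a. k a \<partial>lborel)"
      by (simp only: lborel_distr_plus)
    finally show "(\<integral>\<^sup>+a. 2 * (k (c t + a) * indicator {0..1} t) \<partial>lborel)
        = 2 * (\<integral>\<^sup>+a. k a \<partial>lborel) * indicator {0..1} t"
      by (simp add: nn_integral_cmult nn_integral_multc mult.assoc)
  qed
  also have "\<dots> = 2 * (\<integral>\<^sup>+a. k a \<partial>lborel)"
    by (simp add: nn_integral_cmult_indicator)
  also have "(\<integral>\<^sup>+a. k a \<partial>lborel) = (\<integral>\<^sup>+x\<in>ball z (2 * s). ennreal (cmod (K x)) \<partial>lborel)"
    by (intro nn_integral_cong) (simp add: k_def indicator_def)
  finally show ?thesis .
qed

section \<open>Harmonic functions on a punctured disc\<close>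

text \<open>On a convex set a holomorphic gradient has a primitive, whose real part differs from \<open>\<phi>\<close> by a
  constant; absorbing the constant makes \<open>\<phi>\<close> itself a real part.\<close>
lemma potential_of_holomorphic_gradient:
  assumes S: "convex S" "open S" and f: "f holomorphic_on S"
    and \<phi>: "\<And>z. z \<in> S \<Longrightarrow> (\<phi> has_derivative (\<lambda>v. Re (f z * v))) (at z)"
  obtains \<Phi> where "\<And>z. z \<in> S \<Longrightarrow> (\<Phi> has_field_derivative f z) (at z)"
    and "\<And>z. z \<in> S \<Longrightarrow> \<phi> z = Re (\<Phi> z)"
proof -
  obtain g where g: "\<And>z. z \<in> S \<Longrightarrow> (g has_field_derivative f z) (at z)"
    using holomorphic_convex_primitive'[OF S f] S(2) by (metis at_within_open)
  have "((\<lambda>x. \<phi> x - Re (g x)) has_derivative (\<lambda>v. 0)) (at z within S)" if "z \<in> S" for z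
  proof -
    have "(g has_derivative (\<lambda>v. f z * v)) (at z)"
      using g[OF that] by (simp add: has_field_derivative_def)
    then have "((\<lambda>x. \<phi> x - Re (g x)) has_derivative (\<lambda>v. Re (f z * v) - Re (f z * v))) (at z)"
      by (intro has_derivative_diff \<phi> that has_derivative_Re)
    then show ?thesis by (auto intro: has_derivative_at_withinI)
  qed
  then obtain c where c: "\<And>z. z \<in> S \<Longrightarrow> \<phi> z - Re (g z) = c"
    using has_derivative_zero_constant[OF S(1), of "\<lambda>x. \<phi> x - Re (g x)"] by blast
  show ?thesis
  proof
    show "((\<lambda>z. g z + of_real c) has_field_derivative f z) (at z)" if "z \<in> S" for z
      using g[OF that] by (auto intro!: derivative_eq_intros)
    show "\<phi> z = Re (g z + of_real c)" if "z \<in> S" for z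
      using c[OF that] by simp
  qed
qed

text \<open>The punctured discs shrink to the empty set, so by monotone convergence the integrals over them
  decrease to 0 once one of them is finite.\<close>
lemma nn_integral_punctured_ball_small:
  fixes E :: "complex \<Rightarrow> ennreal"
  assumes r: "r > 0"
    and E: "(\<lambda>x. E x * indicator (ball 0 r - {0}) x) \<in> borel_measurable borel"
    and fin: "(\<integral>\<^sup>+x\<in>ball 0 r - {0}. E x \<partial>lborel) < \<infinity>" and e: "e > 0"
  obtains \<delta> where "0 < \<delta>" "\<delta> \<le> r" "(\<integral>\<^sup>+x\<in>ball 0 \<delta> - {0}. E x \<partial>lborel) < e"
proof -
  define \<delta> where "\<delta> i = r / (real i + 1)" for i :: nat
  define F where "F i x = E x * indicator (ball 0 (\<delta> i) - {0}) x" for i x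
  have \<delta>: "0 < \<delta> i" "\<delta> i \<le> r" for i
    using r by (simp_all add: \<delta>_def field_simps)
  have \<delta>_mono: "\<delta> j \<le> \<delta> i" if "i \<le> j" for i j
    using r that by (simp add: \<delta>_def frac_le)
  have F_eq: "F i x = (E x * indicator (ball 0 r - {0}) x) * indicator (ball 0 (\<delta> i)) x" for i x
    using \<delta>[of i] by (auto simp: F_def indicator_def)
  have "F i = (\<lambda>x. (E x * indicator (ball 0 r - {0}) x) * indicator (ball 0 (\<delta> i)) x)" for i
    using F_eq by blast
  moreover have "(\<lambda>x. (E x * indicator (ball 0 r - {0}) x) * indicator (ball 0 (\<delta> i)) x) \<in> borel_measurable borel" for i
    by (intro borel_measurable_times_ennreal E borel_measurable_indicator) simp
  ultimately have F_meas: "F i \<in> borel_measurable lborel" for i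
    by simp
  have dec: "decseq F"
    unfolding decseq_def
  proof (intro allI impI le_funI)
    fix i j x assume "i \<le> (j :: nat)"
    then show "F j x \<le> F i x"
      using \<delta>_mono[of i j] by (auto simp: F_def indicator_def)
  qed
  have F_fin: "integral\<^sup>N lborel (F i) < \<infinity>" for i
  proof -
    have "integral\<^sup>N lborel (F i) \<le> (\<integral>\<^sup>+x\<in>ball 0 r - {0}. E x \<partial>lborel)"
      using \<delta>(2)[of i] by (intro nn_integral_mono) (auto simp: F_def indicator_def)
    then show ?thesis using fin by (rule le_less_trans)
  qed
  have "(INF i. F i x) = 0" for x
  proof (cases "x = 0")
    case False
    then have "cmod x > 0" by simp
    then obtain i :: nat where "r / cmod x < real i"
      using reals_Archimedean2 by blast
    then have "r < cmod x * real i"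
      using \<open>cmod x > 0\<close> by (simp add: field_simps)
    then have "r < cmod x * (real i + 1)"
      using \<open>cmod x > 0\<close> distrib_left[of "cmod x" "real i" 1] by linarith
    then have "\<delta> i < cmod x"
      by (simp add: \<delta>_def field_simps)
    then have "F i x = 0" by (simp add: F_def)
    then show ?thesis
      by (metis INF_lower UNIV_I le_zero_eq)
  qed (simp add: F_def)
  then have "(INF i. integral\<^sup>N lborel (F i)) = 0"
    using nn_integral_monotone_convergence_INF_decseq[OF dec F_meas F_fin] by simp
  then have "(INF i. integral\<^sup>N lborel (F i)) < e" using e by simp
  then obtain i where "integral\<^sup>N lborel (F i) < e"
    by (auto simp: INF_less_iff)
  then show ?thesis
    using that[of "\<delta> i"] \<delta>[of i] by (simp add: F_def[abs_def])
qed

text \<open>The mean value estimate is applied to the holomorphic function $e^{2\Phi}$ of modulus $e^{2\varphi}$ on the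
  largest disc about \<open>z\<close> that avoids 0. Its area is comparable to $|z|^2$, so $|z|^2e^{2\varphi(z)}$ is at most
  a constant times the area of a small punctured disc around 0.\<close>
lemma finite_area_decay:
  assumes r: "r > 0" and f: "f holomorphic_on ball 0 r - {0}"
    and \<phi>: "\<And>z. z \<in> ball 0 r - {0} \<Longrightarrow> (\<phi> has_derivative (\<lambda>v. Re (f z * v))) (at z)"
    and fin: "(\<integral>\<^sup>+x\<in>ball 0 r - {0}. ennreal (exp (2 * \<phi> x)) \<partial>lborel) < \<infinity>"
  shows "((\<lambda>z. cmod z * exp (\<phi> z)) \<longlongrightarrow> 0) (at 0)"
proof (rule tendstoI)
  fix e :: real assume e: "e > 0"
  have cont: "continuous_on (ball 0 r - {0}) \<phi>"
    using \<phi> by (meson continuous_at_imp_continuous_on has_derivative_continuous)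
  have "(\<lambda>x. ennreal (indicator (ball 0 r - {0}) x *\<^sub>R exp (2 * \<phi> x))) \<in> borel_measurable borel"
    by (intro measurable_compose[OF _ measurable_ennreal] borel_measurable_continuous_on_indicator
        continuous_intros cont) auto
  also have "(\<lambda>x. ennreal (indicator (ball 0 r - {0}) x *\<^sub>R exp (2 * \<phi> x)))
      = (\<lambda>x. ennreal (exp (2 * \<phi> x)) * indicator (ball 0 r - {0}) x)"
    by (auto simp: indicator_def)
  finally have meas: "(\<lambda>x. ennreal (exp (2 * \<phi> x)) * indicator (ball 0 r - {0}) x) \<in> borel_measurable borel" .
  obtain \<delta> where \<delta>: "0 < \<delta>" "\<delta> \<le> r"
    "(\<integral>\<^sup>+x\<in>ball 0 \<delta> - {0}. ennreal (exp (2 * \<phi> x)) \<partial>lborel) < ennreal (pi * e\<^sup>2 / 64)"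
    using nn_integral_punctured_ball_small[OF r meas fin, of "ennreal (pi * e\<^sup>2 / 64)"] e by auto
  have "cmod z * exp (\<phi> z) < e" if z: "z \<noteq> 0" "cmod z < \<delta> / 2" for z
  proof -
    \<comment> \<open>The mean value estimate uses the disc of radius \<open>2 * s\<close>, so this is the largest choice that avoids 0.\<close>
    define s where "s = cmod z / 2"
    have s: "s > 0" using z by (simp add: s_def)
    have sub: "ball z (2 * s) \<subseteq> ball 0 \<delta> - {0}"
    proof
      fix x assume x: "x \<in> ball z (2 * s)"
      then have "cmod x < \<delta>"
        using z norm_triangle_ineq[of z "x - z"] by (simp add: s_def dist_norm norm_minus_commute)
      moreover have "x \<noteq> 0" using x by (auto simp: s_def)
      ultimately show "x \<in> ball 0 \<delta> - {0}" by simp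
    qed
    also have "\<dots> \<subseteq> ball 0 r - {0}" using \<delta>(2) by auto
    finally have sub': "ball z (2 * s) \<subseteq> ball 0 r - {0}" .
    have "(\<phi> has_derivative (\<lambda>v. Re (f x * v))) (at x)" if "x \<in> ball z (2 * s)" for x
      using \<phi> sub' that by blast
    then obtain \<Phi> where \<Phi>: "\<And>x. x \<in> ball z (2 * s) \<Longrightarrow> (\<Phi> has_field_derivative f x) (at x)"
        "\<And>x. x \<in> ball z (2 * s) \<Longrightarrow> \<phi> x = Re (\<Phi> x)"
      using potential_of_holomorphic_gradient[OF convex_ball open_ball holomorphic_on_subset[OF f sub']] by blast
    have "\<Phi> holomorphic_on ball z (2 * s)"
      using \<Phi>(1) holomorphic_on_open open_ball by blast
    then have "(\<lambda>x. exp (2 * \<Phi> x)) holomorphic_on ball z (2 * s)"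
      by (intro holomorphic_intros)
    from holomorphic_norm_le_area_integral[OF this s]
    have "ennreal (cmod (exp (2 * \<Phi> z))) * emeasure lborel (ball z (s / 2))
        \<le> 2 * (\<integral>\<^sup>+x\<in>ball z (2 * s). ennreal (cmod (exp (2 * \<Phi> x))) \<partial>lborel)" .
    also have "\<dots> \<le> 2 * (\<integral>\<^sup>+x\<in>ball 0 \<delta> - {0}. ennreal (exp (2 * \<phi> x)) \<partial>lborel)"
    proof (intro mult_left_mono nn_integral_mono)
      fix x
      show "ennreal (cmod (exp (2 * \<Phi> x))) * indicator (ball z (2 * s)) x
          \<le> ennreal (exp (2 * \<phi> x)) * indicator (ball 0 \<delta> - {0}) x"
        using subsetD[OF sub, of x] \<Phi>(2)[of x] by (cases "x \<in> ball z (2 * s)") auto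
    qed simp
    also have "\<dots> \<le> 2 * ennreal (pi * e\<^sup>2 / 64)"
      using \<delta>(3) by (intro mult_left_mono) auto
    also have "\<dots> = ennreal (pi * e\<^sup>2 / 32)"
      by (simp flip: ennreal_numeral ennreal_mult')
    also have "cmod (exp (2 * \<Phi> z)) = exp (2 * \<phi> z)"
      using s by (simp add: \<Phi>(2))
    also have "emeasure lborel (ball z (s / 2)) = ennreal (pi * (s / 2)\<^sup>2)"
      using s emeasure_ball[of "s / 2" z] by (simp add: eval_unit_ball_vol)
    finally have "exp (2 * \<phi> z) * (pi * (s / 2)\<^sup>2) \<le> pi * e\<^sup>2 / 32"
      by (simp flip: ennreal_mult')
    then have "(cmod z * exp (\<phi> z))\<^sup>2 \<le> e\<^sup>2 / 2"
      unfolding exp_double by (simp add: s_def power_mult_distrib power_divide field_simps)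
    also have "\<dots> < e\<^sup>2" using e by simp
    finally have "(cmod z * exp (\<phi> z))\<^sup>2 < e\<^sup>2" .
    then show ?thesis
      using e by (meson less_imp_le power_less_imp_less_base)
  qed
  then show "\<forall>\<^sub>F z in at 0. dist (cmod z * exp (\<phi> z)) 0 < e"
    using \<delta>(1) unfolding eventually_at by (intro exI[of _ "\<delta> / 2"]) auto
qed

text \<open>The pull-back of \<open>\<phi>\<close> under the exponential map lives on a half plane, which is convex, so it is the
  real part of some \<open>\<Phi>\<close>. Translation by the period changes \<open>\<Phi>\<close> by a constant, which is imaginary because
  the real part of \<open>\<Phi>\<close> is periodic. Subtracting a real multiple of \<open>w\<close> removes this period, and the
  result descends to the punctured disc; the subtracted term becomes the logarithm.\<close>
lemma punctured_disc_log_decomposition: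
  assumes r: "r > 0" and f: "f holomorphic_on ball 0 r - {0}"
    and \<phi>: "\<And>z. z \<in> ball 0 r - {0} \<Longrightarrow> (\<phi> has_derivative (\<lambda>v. Re (f z * v))) (at z)"
  obtains G c where "G holomorphic_on ball 0 r - {0}"
    and "\<And>z. z \<in> ball 0 r - {0} \<Longrightarrow> \<phi> z = Re (G z) + c * ln (cmod z)"
proof -
  define H where "H = {w. Re w < ln r}"
  have H: "convex H" "open H"
    unfolding H_def by (rule convex_halfspace_Re_lt open_halfspace_Re_lt)+
  have exp_less: "exp (Re w) < r \<longleftrightarrow> Re w < ln r" for w
    using r by (metis exp_less_cancel_iff exp_ln)
  have exp_H: "exp w \<in> ball 0 r - {0}" if "w \<in> H" for w
    using that by (simp add: H_def exp_less)
  have Ln_H: "w \<in> H" if "exp w \<in> ball 0 r" for w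
    using that by (simp add: H_def exp_less)
  have lift: "((\<lambda>w. \<phi> (exp w)) has_derivative (\<lambda>v. Re (f (exp w) * exp w * v))) (at w)" if "w \<in> H" for w
  proof -
    have "(exp has_derivative (\<lambda>v. exp w * v)) (at w)"
      using DERIV_exp[of w] by (simp add: has_field_derivative_def)
    from diff_chain_at[OF this \<phi>[OF exp_H[OF that]]]
    show ?thesis by (simp add: o_def mult.assoc)
  qed
  have "(\<lambda>w. f (exp w) * exp w) holomorphic_on H"
    using exp_H by (intro holomorphic_intros holomorphic_on_compose_gen[OF _ f, unfolded o_def]) auto
  then obtain \<Phi> where \<Phi>: "\<And>w. w \<in> H \<Longrightarrow> (\<Phi> has_field_derivative f (exp w) * exp w) (at w)"
      "\<And>w. w \<in> H \<Longrightarrow> \<phi> (exp w) = Re (\<Phi> w)"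
    using potential_of_holomorphic_gradient[OF H _ lift] by blast
  define p where "p = 2 * of_real pi * \<i>"
  have p: "exp (w + p) = exp w" "w + p \<in> H \<longleftrightarrow> w \<in> H" for w
    by (simp_all add: p_def exp_add H_def)
  have "((\<lambda>w. \<Phi> (w + p) - \<Phi> w) has_field_derivative 0) (at w within H)" if "w \<in> H" for w
  proof -
    have "((\<lambda>w. \<Phi> (w + p)) has_field_derivative f (exp w) * exp w) (at w)"
      using \<Phi>(1)[of "w + p"] that p by (simp add: DERIV_shift)
    from DERIV_diff[OF this \<Phi>(1)[OF that]] show ?thesis
      by (simp add: has_field_derivative_at_within)
  qed
  then obtain d where d: "\<And>w. w \<in> H \<Longrightarrow> \<Phi> (w + p) - \<Phi> w = d"
    using has_field_derivative_zero_constant[OF H(1), of "\<lambda>w. \<Phi> (w + p) - \<Phi> w"] by blast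
  have "of_real (ln r - 1) \<in> H" by (simp add: H_def)
  then have Re_d: "Re d = 0"
    using d[of "of_real (ln r - 1)"] \<Phi>(2) p by (metis (no_types) diff_self minus_complex.sel(1))
  \<comment> \<open>The real number \<open>c\<close> for which translation by \<open>p\<close> changes \<open>c * w\<close> by \<open>d\<close>, as it changes \<open>\<Phi>\<close>.\<close>
  define c where "c = Im d / (2 * pi)"
  have c: "of_real c * p = d"
    using Re_d by (simp add: complex_eq_iff c_def p_def)
  define F where "F w = \<Phi> w - of_real c * w" for w
  have F_nat: "F (w + of_nat n * p) = F w" if "w \<in> H" for w n
  proof (induction n)
    case (Suc n)
    have "w + of_nat n * p \<in> H" using that by (simp add: H_def p_def)
    from d[OF this] have "F (w + of_nat n * p + p) = F (w + of_nat n * p)"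
      by (simp add: F_def algebra_simps c[symmetric])
    then show ?case using Suc by (simp add: algebra_simps)
  qed simp
  have F_exp: "F w = F w'" if "exp w = exp w'" "w \<in> H" "w' \<in> H" for w w'
  proof -
    obtain n :: int where n: "w = w' + (of_int (2 * n) * pi) * \<i>"
      using \<open>exp w = exp w'\<close> by (auto simp: exp_eq)
    show ?thesis
    proof (cases "n \<ge> 0")
      case True
      then have "w = w' + of_nat (nat n) * p" using n by (simp add: p_def)
      then show ?thesis using F_nat that by simp
    next
      case False
      then have "w' = w + of_nat (nat (- n)) * p" using n by (simp add: p_def)
      then show ?thesis using F_nat that by simp
    qed
  qed
  have F': "(F has_field_derivative f (exp w) * exp w - of_real c) (at w)" if "w \<in> H" for w
    unfolding F_def using \<Phi>(1)[OF that] by (auto intro!: derivative_eq_intros)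
  define G where "G z = F (Ln z)" for z
  have "\<exists>D. (G has_field_derivative D) (at z)" if z: "z \<in> ball 0 r - {0}" for z
  proof -
    \<comment> \<open>A holomorphic branch of the logarithm near \<open>z\<close>; the principal branch is unsuitable when \<open>z\<close> is on the negative axis, and periodicity of \<open>F\<close> makes the branch irrelevant.\<close>
    define L where "L x = Ln (x / z) + Ln z" for x
    define T where "T = ball z (cmod z) \<inter> ball 0 r"
    \<comment> \<open>On this disc \<open>x / z\<close> stays off the branch cut.\<close>
    have half: "Re (x / z) > 0" if "x \<in> ball z (cmod z)" for x
    proof -
      have "cmod (1 - x / z) < 1"
        using that z by (simp add: dist_norm norm_divide field_simps flip: norm_divide diff_divide_distrib)
           (simp add: norm_divide field_simps)
      then show ?thesis
        using abs_Re_le_cmod[of "1 - x / z"] by simp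
    qed
    have T_nz: "x \<noteq> 0" if "x \<in> T" for x
      using that half[of x] by (auto simp: T_def)
    have L_exp: "exp (L x) = x" if "x \<in> T" for x
      using z T_nz[OF that] by (simp add: L_def exp_add)
    have L_in: "L x \<in> H" if "x \<in> T" for x
      using that L_exp[OF that] by (intro Ln_H) (auto simp: T_def)
    have zT: "z \<in> T" using z by (simp add: T_def)
    have nonpos: "z / z \<notin> \<real>\<^sub>\<le>\<^sub>0" using z by simp
    have "(L has_field_derivative inverse (z / z) * (1 / z)) (at z)"
      unfolding L_def using z nonpos by (auto intro!: derivative_eq_intros)
    then have "((\<lambda>x. F (L x)) has_field_derivative
        (f (exp (L z)) * exp (L z) - of_real c) * (inverse (z / z) * (1 / z))) (at z)"
      by (rule DERIV_chain2[where f = F and g = L and x = z, OF F'[OF L_in[OF zT]]])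
    then have "(G has_field_derivative
        (f (exp (L z)) * exp (L z) - of_real c) * (inverse (z / z) * (1 / z))) (at z)"
    proof (rule has_field_derivative_transform_within_open)
      show "open T" "z \<in> T" using zT by (auto simp: T_def)
      fix x assume x: "x \<in> T"
      then show "F (L x) = G x"
        unfolding G_def using L_exp[OF x] T_nz[OF x] by (intro F_exp L_in Ln_H) (auto simp: T_def)
    qed
    then show ?thesis by blast
  qed
  then have "G holomorphic_on ball 0 r - {0}"
    by (simp add: holomorphic_on_open open_delete)
  moreover have "\<phi> z = Re (G z) + c * ln (cmod z)" if z: "z \<in> ball 0 r - {0}" for z
  proof -
    have "exp (Ln z) = z" using z by simp
    then have "\<phi> z = Re (\<Phi> (Ln z))" using \<Phi>(2)[OF Ln_H] z by (metis DiffD1)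
    then show ?thesis using z by (simp add: G_def F_def)
  qed
  ultimately show ?thesis using that by blast
qed

text \<open>The bound on $|z|e^{\varphi}$ is used twice: after multiplication by a power of \<open>z\<close> it excludes an
  essential singularity of $e^{G}$, and in the resulting normal form it excludes nonpositive cone angles.\<close>
lemma finite_area_logarithmic_pole:
  assumes r: "r > 0" and f: "f holomorphic_on ball 0 r - {0}"
    and \<phi>: "\<And>z. z \<in> ball 0 r - {0} \<Longrightarrow> (\<phi> has_derivative (\<lambda>v. Re (f z * v))) (at z)"
    and fin: "(\<integral>\<^sup>+x\<in>ball 0 r - {0}. ennreal (exp (2 * \<phi> x)) \<partial>lborel) < \<infinity>"
  obtains \<alpha> h where "\<alpha> > 0" "continuous_on (ball 0 r) h"
    "\<And>z. z \<in> ball 0 r - {0} \<Longrightarrow> \<phi> z - (\<alpha> - 1) * ln (cmod z) = h z"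
proof -
  have decay: "((\<lambda>z. cmod z * exp (\<phi> z)) \<longlongrightarrow> 0) (at 0)"
    by (rule finite_area_decay[OF r f \<phi> fin])
  obtain G c where G: "G holomorphic_on ball 0 r - {0}"
    and \<phi>_eq: "\<And>z. z \<in> ball 0 r - {0} \<Longrightarrow> \<phi> z = Re (G z) + c * ln (cmod z)"
    using punctured_disc_log_decomposition[OF r f \<phi>] by blast
  define n where "n = nat \<lceil>1 + c\<rceil>"
  have n: "1 + c \<le> real n"
    unfolding n_def by (rule real_nat_ceiling_ge)
  define H where "H z = z ^ n * exp (G z)" for z
  have ln_H: "ln (cmod (H z)) = \<phi> z + (real n - c) * ln (cmod z)" if "z \<in> ball 0 r - {0}" for z
    using that \<phi>_eq[OF that]
    by (simp add: H_def norm_mult norm_power ln_mult ln_realpow algebra_simps)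
  have H_nz: "H z \<noteq> 0" if "z \<noteq> 0" for z
    using that by (simp add: H_def)
  have H_hol: "H holomorphic_on ball 0 r - {0}"
    unfolding H_def by (intro holomorphic_intros G)
  have H_le: "cmod (H z) \<le> cmod z * exp (\<phi> z)" if z: "z \<in> ball 0 r - {0}" "cmod z < 1" for z
  proof -
    have "(real n - c) * ln (cmod z) \<le> 1 * ln (cmod z)"
      using n z by (intro mult_right_mono_neg) auto
    then have "ln (cmod (H z)) \<le> ln (cmod z * exp (\<phi> z))"
      using z by (simp add: ln_H ln_mult)
    then show ?thesis using z H_nz[of z] by (subst (asm) ln_le_cancel_iff) auto
  qed
  have "(H \<longlongrightarrow> 0) (at 0)"
  proof (rule Lim_null_comparison[OF _ decay])
    show "\<forall>\<^sub>F z in at 0. cmod (H z) \<le> cmod z * exp (\<phi> z)"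
      using r H_le by (auto simp: eventually_at dist_norm intro!: exI[of _ "min r 1"])
  qed
  then have "not_essential H 0"
    unfolding not_essential_def by blast
  moreover have "isolated_singularity_at H 0"
  proof -
    have "H analytic_on ball 0 r - {0}"
      using H_hol by (subst analytic_on_open) (auto simp: open_delete)
    then show ?thesis using r unfolding isolated_singularity_at_def by blast
  qed
  moreover have "\<exists>\<^sub>F z in at 0. H z \<noteq> 0"
  proof (rule eventually_frequently)
    show "\<forall>\<^sub>F z in at 0. H z \<noteq> 0"
      using H_nz by (auto simp: eventually_at intro: exI[of _ 1])
  qed simp
  ultimately have fac: "zor_poly H 0 0 \<noteq> 0 \<and> (\<exists>\<rho>>0. zor_poly H 0 holomorphic_on cball 0 \<rho> \<and>
      (\<forall>w\<in>cball 0 \<rho> - {0}. H w = zor_poly H 0 w * (w - 0) powi zorder H 0 \<and> zor_poly H 0 w \<noteq> 0))"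
    using zorder_exist[of H 0] by blast
  define g m where "g = zor_poly H 0" and "m = zorder H 0"
  from fac obtain \<rho> where g: "g 0 \<noteq> 0" and \<rho>: "\<rho> > 0" and g_hol: "g holomorphic_on cball 0 \<rho>"
    and H_eq: "\<And>w. w \<in> cball 0 \<rho> - {0} \<Longrightarrow> H w = g w * w powi m \<and> g w \<noteq> 0"
    unfolding g_def m_def by auto
  \<comment> \<open>Comparing \<open>ln_H\<close> with the factorisation, the coefficient of the logarithm in \<open>\<phi>\<close> is \<open>m - n + c\<close>.\<close>
  define \<alpha> where "\<alpha> = real_of_int m - real n + c + 1"
  define d where "d = min r \<rho>"
  have d: "d > 0" using r \<rho> by (simp add: d_def)
  have \<phi>_near: "\<phi> z - (\<alpha> - 1) * ln (cmod z) = ln (cmod (g z))" if z: "z \<in> ball 0 d - {0}" for z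
  proof -
    have "H z = g z * z powi m" "g z \<noteq> 0" using H_eq[of z] z by (auto simp: d_def)
    moreover have "ln (cmod z powi m) = real_of_int m * ln (cmod z)"
      using z powr_real_of_int'[of "cmod z" m] ln_powr[of "cmod z" m] by auto
    ultimately have "ln (cmod (H z)) = ln (cmod (g z)) + real_of_int m * ln (cmod z)"
      using z by (simp add: norm_mult norm_power_int ln_mult)
    then show ?thesis using ln_H[of z] z by (simp add: d_def \<alpha>_def algebra_simps)
  qed
  have g_lim: "((\<lambda>z. cmod (g z)) \<longlongrightarrow> cmod (g 0)) (at 0)"
  proof -
    have "isCont g 0"
      using holomorphic_on_imp_continuous_on[OF g_hol] \<rho>
      by (simp add: continuous_on_interior)
    then show ?thesis by (intro tendsto_norm) (simp add: isCont_def)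
  qed
  have "\<alpha> > 0"
  proof (rule ccontr)
    assume "\<not> \<alpha> > 0"
    have "cmod (g z) \<le> cmod z * exp (\<phi> z)" if z: "z \<in> ball 0 d - {0}" "cmod z < 1" for z
    proof -
      have "g z \<noteq> 0" using H_eq[of z] z by (simp add: d_def)
      moreover have "\<alpha> * ln (cmod z) \<ge> 0"
        using \<open>\<not> \<alpha> > 0\<close> z by (intro mult_nonpos_nonpos) auto
      ultimately have "ln (cmod (g z)) \<le> ln (cmod z * exp (\<phi> z))"
        using \<phi>_near[OF z(1)] z by (simp add: ln_mult algebra_simps)
      then show ?thesis using z \<open>g z \<noteq> 0\<close> by (subst (asm) ln_le_cancel_iff) auto
    qed
    then have "\<forall>\<^sub>F z in at 0. cmod (g z) \<le> cmod z * exp (\<phi> z)"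
      using d by (auto simp: eventually_at dist_norm intro!: exI[of _ "min d 1"])
    then have "cmod (g 0) \<le> 0"
      by (rule tendsto_le[OF _ decay g_lim, rotated]) simp
    then show False using g by simp
  qed
  define h where "h z = (if z = 0 then ln (cmod (g 0)) else \<phi> z - (\<alpha> - 1) * ln (cmod z))" for z
  have "isCont h z" if z: "z \<in> ball 0 r" for z
  proof (cases "z = 0")
    case True
    have "((\<lambda>z. ln (cmod (g z))) \<longlongrightarrow> h 0) (at 0)"
      unfolding h_def using g by (simp add: tendsto_ln[OF g_lim])
    then have "(h \<longlongrightarrow> h 0) (at 0)"
    proof (rule Lim_transform_within_open)
      show "open (ball 0 d :: complex set)" "0 \<in> ball 0 d" using d by auto
      show "ln (cmod (g x)) = h x" if "x \<in> ball 0 d" "x \<noteq> 0" for x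
        using \<phi>_near[of x] that by (simp add: h_def)
    qed
    then show ?thesis using True by (simp add: isCont_def)
  next
    case False
    have "isCont \<phi> z" using \<phi>[of z] z False by (simp add: has_derivative_continuous)
    then have "isCont (\<lambda>z. \<phi> z - (\<alpha> - 1) * ln (cmod z)) z"
      using False by (intro continuous_intros) auto
    moreover have "\<forall>\<^sub>F x in nhds z. h x = \<phi> x - (\<alpha> - 1) * ln (cmod x)"
      unfolding eventually_nhds using False
      by (intro exI[of _ "- {0}"]) (auto simp: h_def)
    ultimately show ?thesis
      by (simp add: isCont_cong)
  qed
  then have "continuous_on (ball 0 r) h"
    by (simp add: continuous_at_imp_continuous_on)
  with \<open>\<alpha> > 0\<close> show ?thesis
    by (rule that) (simp add: h_def)
qed

section \<open>Coordinates centred at a point\<close>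

lemma chart_inj_on:
  assumes "chart X (U, w)"
  shows "inj_on w U"
proof -
  have "openin X U" "homeomorphic_map (subtopology X U) (top_of_set (w ` U)) w"
    using assms by (auto simp: chart_def)
  then show ?thesis
    using homeomorphic_imp_injective_map openin_subset topspace_subtopology_subset by metis
qed

lemma chart_restrict_translate:
  assumes w: "chart X (U, w)" and U': "openin X U'" "U' \<subseteq> U"
  shows "chart X (U', \<lambda>x. w x - c)"
proof -
  have X: "openin X U" "open (w ` U)" "homeomorphic_map (subtopology X U) (top_of_set (w ` U)) w"
    using w by (auto simp: chart_def)
  have U: "topspace (subtopology X U) = U" "U' \<subseteq> topspace (subtopology X U)"
    using X(1) U' openin_subset by fastforce+
  have "openin (subtopology X U) U'"
    using U' X(1) by (simp add: openin_open_subtopology)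
  then have "openin (top_of_set (w ` U)) (w ` U')"
    using homeomorphic_imp_open_map[OF X(3)] by (simp add: open_map_def)
  then have w_open: "open (w ` U')"
    using X(2) by (simp add: openin_open_eq)
  have "homeomorphic_map (subtopology (subtopology X U) U') (subtopology (top_of_set (w ` U)) (w ` U')) w"
    by (rule homeomorphic_map_subtopologies[OF X(3)]) (use U U' in auto)
  moreover have "subtopology (subtopology X U) U' = subtopology X U'"
    "subtopology (top_of_set (w ` U)) (w ` U') = top_of_set (w ` U')"
    using U'(2) by (auto simp: subtopology_subtopology Int_absorb1 image_mono)
  ultimately have hw: "homeomorphic_map (subtopology X U') (top_of_set (w ` U')) w" by simp
  have img: "(\<lambda>x. w x - c) ` U' = (\<lambda>x. x - c) ` w ` U'" by auto
  have "homeomorphic_map (top_of_set (w ` U')) (top_of_set ((\<lambda>x. w x - c) ` U')) (\<lambda>x. x - c)"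
    unfolding homeomorphic_map_maps
    by (intro exI[of _ "\<lambda>x. x + c"]) (auto simp: homeomorphic_maps_def intro!: continuous_intros)
  from homeomorphic_map_compose[OF hw this]
  have "homeomorphic_map (subtopology X U') (top_of_set ((\<lambda>x. w x - c) ` U')) (\<lambda>x. w x - c)"
    by (simp add: o_def)
  moreover have "open ((\<lambda>x. w x - c) ` U')"
    unfolding img using open_translation_subtract[OF w_open, of c] by simp
  ultimately show ?thesis
    using U'(1) by (simp add: chart_def)
qed

lemma compatible_restrict_translate:
  assumes comp: "compatible (U, w) l" and inj: "inj_on w U" and U': "U' \<subseteq> U"
  shows "compatible (U', \<lambda>x. w x - c) l"
proof -
  have 1: "coord_change (U, w) l holomorphic_on w ` (U \<inter> fst l)"
    and 2: "coord_change l (U, w) holomorphic_on snd l ` (U \<inter> fst l)"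
    using comp by (auto simp: compatible_def)
  have inj': "inj_on (\<lambda>x. w x - c) U'"
    using inj U' by (auto simp: inj_on_def)
  have "(coord_change (U, w) l \<circ> (\<lambda>y. y + c)) holomorphic_on (\<lambda>x. w x - c) ` (U' \<inter> fst l)"
    by (rule holomorphic_on_compose_gen[OF _ 1]) (use U' in \<open>auto intro!: holomorphic_intros\<close>)
  moreover have "(coord_change (U, w) l \<circ> (\<lambda>y. y + c)) y = coord_change (U', \<lambda>x. w x - c) l y"
    if "y \<in> (\<lambda>x. w x - c) ` (U' \<inter> fst l)" for y
  proof -
    from that obtain x where x: "x \<in> U'" "y = w x - c" by blast
    have "inv_into U' (\<lambda>x. w x - c) y = x"
      unfolding x(2) using inv_into_f_f[OF inj' x(1)] .
    moreover have "inv_into U w (y + c) = x"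
      using x U' inv_into_f_f[OF inj, of x] by auto
    ultimately show ?thesis by (simp add: coord_change_def)
  qed
  ultimately have "coord_change (U', \<lambda>x. w x - c) l holomorphic_on (\<lambda>x. w x - c) ` (U' \<inter> fst l)"
    by (metis (no_types, lifting) holomorphic_cong)
  moreover have "(\<lambda>y. coord_change l (U, w) y - c) holomorphic_on snd l ` (U' \<inter> fst l)"
    using U' by (intro holomorphic_intros holomorphic_on_subset[OF 2]) auto
  then have "coord_change l (U', \<lambda>x. w x - c) holomorphic_on snd l ` (U' \<inter> fst l)"
    by (simp add: coord_change_def o_def)
  ultimately show ?thesis by (simp add: compatible_def)
qed

text \<open>Any chart around \<open>p\<close> becomes such a coordinate after shrinking its domain and translating its
  values, operations that preserve compatibility with the atlas.\<close>
lemma centred_disc_coordinate: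
  assumes X: "riemann_surface X \<A>" and p: "p \<in> topspace X" and V: "openin X V" "p \<in> V"
  obtains U z r where "(U, z) \<in> coords X \<A>" "p \<in> U" "U \<subseteq> V" "z p = 0"
    "r > 0" "z ` U = ball 0 r" "inj_on z U"
proof -
  have "p \<in> (\<Union>k\<in>\<A>. fst k)"
    using X p by (simp add: riemann_surface_def)
  then obtain k where "k \<in> \<A>" "p \<in> fst k" by blast
  then obtain U0 w where U0: "(U0, w) \<in> \<A>" "p \<in> U0" by (cases k) auto
  have ch: "chart X (U0, w)" and comp: "\<And>l. l \<in> \<A> \<Longrightarrow> compatible (U0, w) l"
    using X U0 by (auto simp: riemann_surface_def)
  have inj: "inj_on w U0" by (rule chart_inj_on[OF ch])
  have U0V: "openin X (U0 \<inter> V)"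
    using ch V by (auto simp: chart_def)
  have "chart X (U0 \<inter> V, \<lambda>x. w x - w p)"
    using chart_restrict_translate[OF ch U0V] by simp
  then have cz: "open ((\<lambda>x. w x - w p) ` (U0 \<inter> V))"
      "homeomorphic_map (subtopology X (U0 \<inter> V)) (top_of_set ((\<lambda>x. w x - w p) ` (U0 \<inter> V))) (\<lambda>x. w x - w p)"
    by (auto simp: chart_def)
  have "0 \<in> (\<lambda>x. w x - w p) ` (U0 \<inter> V)" using U0 V by force
  then obtain r where r: "r > 0" "ball 0 r \<subseteq> (\<lambda>x. w x - w p) ` (U0 \<inter> V)"
    using cz(1) openE by blast
  define U where "U = {x \<in> U0 \<inter> V. w x - w p \<in> ball 0 r}"
  have "continuous_map (subtopology X (U0 \<inter> V)) euclidean (\<lambda>x. w x - w p)"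
    using homeomorphic_imp_continuous_map[OF cz(2)] continuous_map_into_fulltopology by blast
  then have "openin (subtopology X (U0 \<inter> V)) {x \<in> topspace (subtopology X (U0 \<inter> V)). w x - w p \<in> ball 0 r}"
    by (rule openin_continuous_map_preimage) auto
  moreover have "topspace (subtopology X (U0 \<inter> V)) = U0 \<inter> V"
    by (rule topspace_subtopology_subset[OF openin_subset[OF U0V]])
  ultimately have "openin (subtopology X (U0 \<inter> V)) U"
    by (simp only: U_def)
  then have U_open: "openin X U"
    using openin_open_subtopology[OF U0V] by blast
  have U_sub: "U \<subseteq> U0" "U \<subseteq> V" by (auto simp: U_def)
  show ?thesis
  proof
    show "(U, \<lambda>x. w x - w p) \<in> coords X \<A>"
      using chart_restrict_translate[OF ch U_open U_sub(1)]
        compatible_restrict_translate[OF comp inj U_sub(1)]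
      by (simp add: coords_def)
    show "(\<lambda>x. w x - w p) ` U = ball 0 r"
    proof (intro equalityI subsetI)
      fix y :: complex assume y: "y \<in> ball 0 r"
      then obtain x where "x \<in> U0 \<inter> V" "y = w x - w p" using r(2) by blast
      then show "y \<in> (\<lambda>x. w x - w p) ` U" using y unfolding U_def by blast
    qed (auto simp: U_def)
    show "inj_on (\<lambda>x. w x - w p) U"
      using inj U_sub by (auto simp: inj_on_def)
    show "p \<in> U" using U0 V r by (simp add: U_def)
  qed (use U_sub r in auto)
qed

section \<open>Isolated singularities of flat metrics\<close>

theorem corollary1p5:
  fixes X :: "'a topology" and \<A> :: "'a coord set" and V :: "'a set" and p :: 'a
    and g :: "'a metric_tensor"
  assumes "riemann_surface X \<A>"
    and "p \<in> topspace X" and "openin X V" and "p \<in> V"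
    and "conformal_metric_on X \<A> (V - {p}) g"
    and "flat_on X \<A> (V - {p}) g"
    and "area X \<A> (V - {p}) g < \<infinity>"
  shows "\<exists>\<alpha>>0. conical_singularity X \<A> (V - {p}) g p (2 * pi * \<alpha>)"
proof -
  obtain U z r where k: "(U, z) \<in> coords X \<A>" and U: "p \<in> U" "U \<subseteq> V"
    and z: "z p = 0" "z ` U = ball 0 r" "inj_on z U" and r: "r > 0"
    by (rule centred_disc_coordinate[OF assms(1-4)])
  define D where "D = ball 0 r - {0 :: complex}"
  have D: "open D" by (simp add: D_def open_delete)
  have z_punct: "z ` (U - {p}) = D"
    using z U by (simp add: D_def inj_on_image_set_diff[of z U])
  have "U \<inter> (V - {p}) = U - {p}" using U by blast
  then have coord_D: "coord_image (V - {p}) (U, z) = D"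
    using z_punct by (simp add: coord_image_def)
  obtain \<phi> where \<phi>: "smooth_on D \<phi>" and g: "\<And>x. x \<in> D \<Longrightarrow> g (U, z) x = conformal_form \<phi> x"
    using assms(5) k coord_D unfolding conformal_metric_on_def by metis
  have "gauss_curvature (g (U, z)) x = 0" if "x \<in> D" for x
    using assms(6) k that coord_D unfolding flat_on_def by blast
  then have harmonic: "partial 1 (partial 1 \<phi>) x + partial \<i> (partial \<i> \<phi>) x = 0" if "x \<in> D" for x
    using gauss_curvature_conformal[OF \<phi> D that g] that by simp
  have "{((U, z), U - {p})} \<in> area_pieces X \<A> (V - {p})"
    using k U z_punct D by (auto simp: area_pieces_def pairwise_def)
  then have "(\<integral>\<^sup>+x\<in>D. ennreal (sqrt (gram_det (g (U, z)) x)) \<partial>lborel) \<le> area X \<A> (V - {p}) g"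
    unfolding area_def by (rule SUP_upper2) (simp add: z_punct)
  moreover have "(\<integral>\<^sup>+x\<in>D. ennreal (sqrt (gram_det (g (U, z)) x)) \<partial>lborel)
      = (\<integral>\<^sup>+x\<in>D. ennreal (exp (2 * \<phi> x)) \<partial>lborel)"
    by (intro nn_integral_cong) (auto simp: indicator_def gram_det_conformal[OF g])
  ultimately have fin: "(\<integral>\<^sup>+x\<in>D. ennreal (exp (2 * \<phi> x)) \<partial>lborel) < \<infinity>"
    using assms(7) by (metis order.strict_trans1)
  obtain \<alpha> h where \<alpha>: "\<alpha> > 0" and h: "continuous_on (ball 0 r) h"
    "\<And>x. x \<in> D \<Longrightarrow> \<phi> x - (\<alpha> - 1) * ln (cmod x) = h x"
    by (rule finite_area_logarithmic_pole[OF r complex_gradient_holomorphic[OF \<phi> D harmonic, unfolded D_def]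
            has_derivative_complex_gradient[OF smooth_on_differentiable[OF \<phi>], unfolded D_def]
            fin[unfolded D_def]])
       (auto simp: D_def)
  have "conical_singularity X \<A> (V - {p}) g p (2 * pi * \<alpha>)"
    unfolding conical_singularity_def
  proof (intro conjI exI)
    show "U - {p} \<subseteq> V - {p}" using U by blast
    show "\<forall>x\<in>z ` U - {0}. g (U, z) x = conformal_form \<phi> x"
      using g z by (simp add: D_def)
    show "continuous_on (z ` U) h" using h z by simp
    show "\<forall>x\<in>z ` U - {0}. \<phi> x - (2 * pi * \<alpha> / (2 * pi) - 1) * ln (cmod x) = h x"
      using h z by (simp add: D_def)
  qed (use \<alpha> k U z in auto)
  then show ?thesis using \<alpha> by blast
qed

end
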